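(* Let $\epsilon>0$ and let $\Delta t>0$ be the time-step size. For each of the four approximate point queue models ($\epsilon$-PQM1, $\epsilon$-PQM2, $\epsilon$-PQM3, $\epsilon$-PQM4), the discrete version is well-defined if and only if the continuous version is well-defined and $\Delta t\le\epsilon$.
   Context: A point queue has storage capacity $\Lambda>0$, origin demand $\delta(t)\ge0$ and destination supply $\sigma(t)\ge0$ (continuous functions of $t\ge0$), and initial size $\Lambda_0\in[0,\Lambda]$. State variables: queue size $\lambda_\epsilon(t)=F_\epsilon(t)-G_\epsilon(t)$, with cumulative in- and out-flows $F_\epsilon,G_\epsilon$; $\lambda_\epsilon(0)=F_\epsilon(0)=\Lambda_0$, $G_\epsilon(0)=0$. Demand and supply functions: - $\epsilon$-PQM1: $d_\epsilon=\delta(t)+\frac{\lambda_\epsilon(t)}{\epsilon}$, $s_\epsilon=\sigma(t)+\frac{\Lambda-\lambda_\epsilon(t)}{\epsilon}$; - $\epsilon$-PQM2: $d_\epsilon=\frac{\lambda_\epsilon(t)}{\epsilon}$, $s_\epsilon=\frac{\Lambda-\lambda_\epsilon(t)}{\epsilon}$; - $\epsilon$-PQM3: $d_\epsilon=\delta(t)+\frac{\lambda_\epsilon(t)}{\epsilon}$, $s_\epsilon=\frac{\Lambda-\lambda_\epsilon(t)}{\epsilon}$; - $\epsilon$-PQM4: $d_\epsilon=\frac{\lambda_\epsilon(t)}{\epsilon}$, $s_\epsilon=\sigma(t)+\frac{\Lambda-\lambda_\epsilon(t)}{\epsilon}$. Continuous versions: (A) $\frac{d}{dt}\lambda_\epsilon=\min\{\delta,s_\epsilon\}-\min\{d_\epsilon,\sigma\}$;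 or (B) $\frac{d}{dt}F_\epsilon=\min\{\delta,s_\epsilon\}$, $\frac{d}{dt}G_\epsilon=\min\{d_\epsilon,\sigma\}$. A continuous version is well-defined if and only if $\lambda_\epsilon(t)$ is always in $[0,\Lambda]$ in (A), or $G_\epsilon(t)\le F_\epsilon(t)\le G_\epsilon(t)+\Lambda$ always in (B), whatever the initial size $\Lambda_0\in[0,\Lambda]$. Discrete versions: (A) $\lambda_\epsilon(t+\Delta t)=\lambda_\epsilon(t)+\min\{\delta(t)\Delta t,s_\epsilon(t)\Delta t\}-\min\{d_\epsilon(t)\Delta t,\sigma(t)\Delta t\}$; or (B) $F_\epsilon(t+\Delta t)=F_\epsilon(t)+\min\{\delta(t)\Delta t,s_\epsilon(t)\Delta t\}$, $G_\epsilon(t+\Delta t)=G_\epsilon(t)+\min\{d_\epsilon(t)\Delta t,\sigma(t)\Delta t\}$. A discrete version is well-defined if and only if, at each time step $t$, $\lambda_\epsilon(t+\Delta t)\in[0,\Lambda]$ for every $\lambda_\epsilon(t)\in[0,\Lambda]$ in (A); respectively $G_\epsilon(t+\Delta t)\le F_\epsilon(t+\Delta t)\le G_\epsilon(t+\Delta t)+\Lambda$ for all $G_\epsilon(t)\le F_\epsilon(t)\le G_\epsilon(t)+\Lambda$ in (B). Well-definedness (continuous and discrete) is understood as follows with respect to the data: for $\epsilon$-PQM1 and $\epsilon$-PQM2, for all $\delta,\sigma\ge0$; for $\epsilon$-PQM3, for given $\sigma$ and all $\delta\ge0$; for $\epsilon$-PQM4, for given $\delta$ and all $\sigma\ge0$.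 *)

theory Defs
  imports Complex_Main
begin

datatype pqm = PQM1 | PQM2 | PQM3 | PQM4

fun queue_demand :: "pqm \<Rightarrow> real \<Rightarrow> (real \<Rightarrow> real) \<Rightarrow> real \<Rightarrow> real \<Rightarrow> real" where
  "queue_demand PQM1 \<epsilon> \<delta> t l = \<delta> t + l / \<epsilon>"
| "queue_demand PQM2 \<epsilon> \<delta> t l = l / \<epsilon>"
| "queue_demand PQM3 \<epsilon> \<delta> t l = \<delta> t + l / \<epsilon>"
| "queue_demand PQM4 \<epsilon> \<delta> t l = l / \<epsilon>"

fun queue_supply :: "pqm \<Rightarrow> real \<Rightarrow> real \<Rightarrow> (real \<Rightarrow> real) \<Rightarrow> real \<Rightarrow> real \<Rightarrow> real" where
  "queue_supply PQM1 \<epsilon> \<Lambda> \<sigma> t l = \<sigma> t + (\<Lambda> - l) / \<epsilon>"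
| "queue_supply PQM2 \<epsilon> \<Lambda> \<sigma> t l = (\<Lambda> - l) / \<epsilon>"
| "queue_supply PQM3 \<epsilon> \<Lambda> \<sigma> t l = (\<Lambda> - l) / \<epsilon>"
| "queue_supply PQM4 \<epsilon> \<Lambda> \<sigma> t l = \<sigma> t + (\<Lambda> - l) / \<epsilon>"

text \<open>Time is represented by the half-line of nonnegative reals; values at negative
  arguments are irrelevant.\<close>

definition admissible :: "(real \<Rightarrow> real) \<Rightarrow> bool" where
  "admissible f \<longleftrightarrow> continuous_on {0..} f \<and> (\<forall>t\<ge>0. 0 \<le> f t)"

text \<open>The pairs (origin demand, destination supply) over which well-definedness quantifies:
  everything admissible for the first two models, while the third keeps the given supply
  \<open>\<sigma>0\<close> and the fourth the given demand \<open>\<delta>0\<close>.\<close>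

fun boundary_data ::
  "pqm \<Rightarrow> (real \<Rightarrow> real) \<Rightarrow> (real \<Rightarrow> real) \<Rightarrow> ((real \<Rightarrow> real) \<times> (real \<Rightarrow> real)) set" where
  "boundary_data PQM1 \<delta>0 \<sigma>0 = {(\<delta>, \<sigma>). admissible \<delta> \<and> admissible \<sigma>}"
| "boundary_data PQM2 \<delta>0 \<sigma>0 = {(\<delta>, \<sigma>). admissible \<delta> \<and> admissible \<sigma>}"
| "boundary_data PQM3 \<delta>0 \<sigma>0 = {(\<delta>, \<sigma>). admissible \<delta> \<and> \<sigma> = \<sigma>0}"
| "boundary_data PQM4 \<delta>0 \<sigma>0 = {(\<delta>, \<sigma>). \<delta> = \<delta>0 \<and> admissible \<sigma>}"

definition solution_A ::
  "pqm \<Rightarrow> real \<Rightarrow> real \<Rightarrow> (real \<Rightarrow> real) \<Rightarrow> (real \<Rightarrow> real) \<Rightarrow> real \<Rightarrow> (real \<Rightarrow> real) \<Rightarrow> bool" where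
  "solution_A m \<epsilon> \<Lambda> \<delta> \<sigma> \<Lambda>0 q \<longleftrightarrow>
     q 0 = \<Lambda>0 \<and>
     (\<forall>t\<ge>0. (q has_real_derivative
        min (\<delta> t) (queue_supply m \<epsilon> \<Lambda> \<sigma> t (q t)) - min (queue_demand m \<epsilon> \<delta> t (q t)) (\<sigma> t))
        (at t within {0..}))"

definition solution_B ::
  "pqm \<Rightarrow> real \<Rightarrow> real \<Rightarrow> (real \<Rightarrow> real) \<Rightarrow> (real \<Rightarrow> real) \<Rightarrow> real \<Rightarrow>
   (real \<Rightarrow> real) \<Rightarrow> (real \<Rightarrow> real) \<Rightarrow> bool" where
  "solution_B m \<epsilon> \<Lambda> \<delta> \<sigma> \<Lambda>0 F G \<longleftrightarrow>
     F 0 = \<Lambda>0 \<and> G 0 = 0 \<and>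
     (\<forall>t\<ge>0. (F has_real_derivative min (\<delta> t) (queue_supply m \<epsilon> \<Lambda> \<sigma> t (F t - G t))) (at t within {0..})
          \<and> (G has_real_derivative min (queue_demand m \<epsilon> \<delta> t (F t - G t)) (\<sigma> t)) (at t within {0..}))"

text \<open>Quantifying over all solutions is not vacuous: the right-hand sides are continuous in
  time and globally Lipschitz in the state, so each initial value problem has exactly one
  solution on the whole half-line.\<close>

definition continuous_well_defined_A ::
  "pqm \<Rightarrow> real \<Rightarrow> real \<Rightarrow> (real \<Rightarrow> real) \<Rightarrow> (real \<Rightarrow> real) \<Rightarrow> bool" where
  "continuous_well_defined_A m \<epsilon> \<Lambda> \<delta>0 \<sigma>0 \<longleftrightarrow>
     (\<forall>(\<delta>, \<sigma>) \<in> boundary_data m \<delta>0 \<sigma>0. \<forall>\<Lambda>0 \<in> {0..\<Lambda>}. \<forall>q.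
        solution_A m \<epsilon> \<Lambda> \<delta> \<sigma> \<Lambda>0 q \<longrightarrow> (\<forall>t\<ge>0. q t \<in> {0..\<Lambda>}))"

definition continuous_well_defined_B ::
  "pqm \<Rightarrow> real \<Rightarrow> real \<Rightarrow> (real \<Rightarrow> real) \<Rightarrow> (real \<Rightarrow> real) \<Rightarrow> bool" where
  "continuous_well_defined_B m \<epsilon> \<Lambda> \<delta>0 \<sigma>0 \<longleftrightarrow>
     (\<forall>(\<delta>, \<sigma>) \<in> boundary_data m \<delta>0 \<sigma>0. \<forall>\<Lambda>0 \<in> {0..\<Lambda>}. \<forall>F G.
        solution_B m \<epsilon> \<Lambda> \<delta> \<sigma> \<Lambda>0 F G \<longrightarrow> (\<forall>t\<ge>0. G t \<le> F t \<and> F t \<le> G t + \<Lambda>))"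

definition step_A ::
  "pqm \<Rightarrow> real \<Rightarrow> real \<Rightarrow> real \<Rightarrow> (real \<Rightarrow> real) \<Rightarrow> (real \<Rightarrow> real) \<Rightarrow> real \<Rightarrow> real \<Rightarrow> real" where
  "step_A m \<epsilon> \<Lambda> dt \<delta> \<sigma> t l =
     l + min (\<delta> t * dt) (queue_supply m \<epsilon> \<Lambda> \<sigma> t l * dt)
       - min (queue_demand m \<epsilon> \<delta> t l * dt) (\<sigma> t * dt)"

definition step_B ::
  "pqm \<Rightarrow> real \<Rightarrow> real \<Rightarrow> real \<Rightarrow> (real \<Rightarrow> real) \<Rightarrow> (real \<Rightarrow> real) \<Rightarrow> real \<Rightarrow> real \<times> real \<Rightarrow> real \<times> real"
  where
  "step_B m \<epsilon> \<Lambda> dt \<delta> \<sigma> t = (\<lambda>(f, g).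
     (f + min (\<delta> t * dt) (queue_supply m \<epsilon> \<Lambda> \<sigma> t (f - g) * dt),
      g + min (queue_demand m \<epsilon> \<delta> t (f - g) * dt) (\<sigma> t * dt)))"

text \<open>A time step may start at any time \<open>t \<ge> 0\<close>, not only at a multiple of \<open>dt\<close>: otherwise
  the discrete third model would not see the given supply between the grid points, whereas the
  continuous one does (and similarly for the fourth model and the given demand).\<close>

definition discrete_well_defined_A ::
  "pqm \<Rightarrow> real \<Rightarrow> real \<Rightarrow> real \<Rightarrow> (real \<Rightarrow> real) \<Rightarrow> (real \<Rightarrow> real) \<Rightarrow> bool" where
  "discrete_well_defined_A m \<epsilon> \<Lambda> dt \<delta>0 \<sigma>0 \<longleftrightarrow>
     (\<forall>(\<delta>, \<sigma>) \<in> boundary_data m \<delta>0 \<sigma>0. \<forall>t\<ge>0. \<forall>l \<in> {0..\<Lambda>}.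
        step_A m \<epsilon> \<Lambda> dt \<delta> \<sigma> t l \<in> {0..\<Lambda>})"

definition discrete_well_defined_B ::
  "pqm \<Rightarrow> real \<Rightarrow> real \<Rightarrow> real \<Rightarrow> (real \<Rightarrow> real) \<Rightarrow> (real \<Rightarrow> real) \<Rightarrow> bool" where
  "discrete_well_defined_B m \<epsilon> \<Lambda> dt \<delta>0 \<sigma>0 \<longleftrightarrow>
     (\<forall>(\<delta>, \<sigma>) \<in> boundary_data m \<delta>0 \<sigma>0. \<forall>t\<ge>0. \<forall>f g f' g'.
        g \<le> f \<and> f \<le> g + \<Lambda> \<and> step_B m \<epsilon> \<Lambda> dt \<delta> \<sigma> t (f, g) = (f', g')
          \<longrightarrow> g' \<le> f' \<and> f' \<le> g' + \<Lambda>)"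

end

theory Submission
  imports Defs "HOL-Analysis.Henstock_Kurzweil_Integration"
begin

text \<open>The rate of change \<open>r(l)\<close> of the queue size satisfies \<open>r(l) \<ge> -max 0 l / \<epsilon>\<close> for
  \<open>l \<le> \<Lambda>\<close>, provided the given supply in the third model (the given demand in the fourth) never
  exceeds \<open>\<Lambda> / \<epsilon>\<close>. For \<open>l < 0\<close> this says that a negative queue cannot decrease, so a
  solution never becomes negative; for \<open>l \<ge> 0\<close> it says that an Euler step of length at most
  \<open>\<epsilon>\<close> stays nonnegative. The upper bound is the lower bound for the mirrored queue, in which
  vacancies \<open>\<Lambda> - l\<close> travel backwards and demand and supply are exchanged.

  Conversely, if the given supply \<open>\<sigma>\<close> of the third model exceeds \<open>\<Lambda> / \<epsilon>\<close> somewhere, the demand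
  \<open>\<delta> = \<sigma> - q / \<epsilon>\<close> turns the equation into the linear one
  \<open>q' = - q / \<epsilon> - max 0 (\<sigma> - \<Lambda> / \<epsilon>)\<close>, whose solution with \<open>q 0 = 0\<close> is explicit and becomes
  negative. A step longer than \<open>\<epsilon>\<close> is ruled out by a queue that overshoots its emptying or its
  filling.\<close>

section \<open>Net inflow, mirror symmetry and the capacity condition\<close>

definition net_inflow ::
  "pqm \<Rightarrow> real \<Rightarrow> real \<Rightarrow> (real \<Rightarrow> real) \<Rightarrow> (real \<Rightarrow> real) \<Rightarrow> real \<Rightarrow> real \<Rightarrow> real" where
  "net_inflow m \<epsilon> \<Lambda> \<delta> \<sigma> t l =
     min (\<delta> t) (queue_supply m \<epsilon> \<Lambda> \<sigma> t l) - min (queue_demand m \<epsilon> \<delta> t l) (\<sigma> t)"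

fun mirror :: "pqm \<Rightarrow> pqm" where
  "mirror PQM1 = PQM1"
| "mirror PQM2 = PQM2"
| "mirror PQM3 = PQM4"
| "mirror PQM4 = PQM3"

text \<open>The explicit criterion through which the two notions of well-definedness are compared:
  the continuous version turns out to be equivalent to it, the discrete version to it together with
  \<open>dt \<le> \<epsilon>\<close>.\<close>

fun capacity_condition :: "pqm \<Rightarrow> real \<Rightarrow> real \<Rightarrow> (real \<Rightarrow> real) \<Rightarrow> (real \<Rightarrow> real) \<Rightarrow> bool" where
  "capacity_condition PQM1 \<epsilon> \<Lambda> \<delta>0 \<sigma>0 \<longleftrightarrow> True"
| "capacity_condition PQM2 \<epsilon> \<Lambda> \<delta>0 \<sigma>0 \<longleftrightarrow> True"
| "capacity_condition PQM3 \<epsilon> \<Lambda> \<delta>0 \<sigma>0 \<longleftrightarrow> (\<forall>t\<ge>0. \<sigma>0 t \<le> \<Lambda> / \<epsilon>)"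
| "capacity_condition PQM4 \<epsilon> \<Lambda> \<delta>0 \<sigma>0 \<longleftrightarrow> (\<forall>t\<ge>0. \<delta>0 t \<le> \<Lambda> / \<epsilon>)"

lemma mirror_mirror [simp]: "mirror (mirror m) = m"
  by (cases m) auto

lemma capacity_condition_mirror:
  "capacity_condition (mirror m) \<epsilon> \<Lambda> \<sigma>0 \<delta>0 \<longleftrightarrow> capacity_condition m \<epsilon> \<Lambda> \<delta>0 \<sigma>0"
  by (cases m) auto

lemma boundary_data_mirror:
  "(\<sigma>, \<delta>) \<in> boundary_data (mirror m) \<sigma>0 \<delta>0 \<longleftrightarrow> (\<delta>, \<sigma>) \<in> boundary_data m \<delta>0 \<sigma>0"
  by (cases m) auto

lemma net_inflow_mirror:
  "net_inflow (mirror m) \<epsilon> \<Lambda> \<sigma> \<delta> t (\<Lambda> - l) = - net_inflow m \<epsilon> \<Lambda> \<delta> \<sigma> t l"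
  by (cases m) (auto simp: net_inflow_def min.commute)

lemma boundary_data_admissible:
  assumes "admissible \<delta>0" "admissible \<sigma>0" "(\<delta>, \<sigma>) \<in> boundary_data m \<delta>0 \<sigma>0"
  shows "admissible \<delta>" "admissible \<sigma>"
  using assms by (cases m; auto)+

text \<open>In each case the outflow is at most the inflow plus \<open>max 0 l / \<epsilon>\<close>.
  If the outflow is limited by \<open>l / \<epsilon>\<close> alone, nonnegativity of the inflow
  suffices. In \<open>PQM3\<close> the capacity condition handles the inflow
  \<open>(\<Lambda> - l) / \<epsilon>\<close>: the outflow is then at most
  \<open>\<sigma> t \<le> \<Lambda> / \<epsilon>\<close>, which is that inflow plus
  \<open>l / \<epsilon>\<close>.\<close>

lemma net_inflow_lower_bound:
  assumes "\<epsilon> > 0" "\<Lambda> > 0" "l \<le> \<Lambda>" "t \<ge> 0"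
    and "admissible \<delta>0" "admissible \<sigma>0" "(\<delta>, \<sigma>) \<in> boundary_data m \<delta>0 \<sigma>0"
    and "capacity_condition m \<epsilon> \<Lambda> \<delta>0 \<sigma>0"
  shows "- (max 0 l / \<epsilon>) \<le> net_inflow m \<epsilon> \<Lambda> \<delta> \<sigma> t l"
proof -
  \<comment> \<open>In terms of these two rates the claim is linear arithmetic with
    \<open>min\<close> and \<open>max\<close>.\<close>
  define x L where "x = l / \<epsilon>" and "L = \<Lambda> / \<epsilon>"
  have *: "(\<Lambda> - l) / \<epsilon> = L - x" "l / \<epsilon> = x" "max 0 l / \<epsilon> = max 0 x"
    using \<open>\<epsilon> > 0\<close> by (auto simp: x_def L_def diff_divide_distrib max_def zero_le_divide_iff)
  have "x \<le> L" "0 < L"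
    using assms by (auto simp: x_def L_def divide_right_mono)
  moreover have "0 \<le> \<delta> t" "0 \<le> \<sigma> t"
    using boundary_data_admissible[OF assms(5-7)] \<open>t \<ge> 0\<close> by (auto simp: admissible_def)
  moreover have "m = PQM3 \<Longrightarrow> \<sigma> t \<le> L" "m = PQM4 \<Longrightarrow> \<delta> t \<le> L"
    using assms by (auto simp: L_def)
  ultimately show ?thesis
    by (cases m) (auto simp: net_inflow_def *)
qed

section \<open>Differentiation and integration on the half-line\<close>

lemma at_within_atLeast_interior: "at t within {0..} = at t" if "t > (0::real)"
  using that by (intro at_within_interior) (simp add: interior_real_atLeast)

text \<open>Barrier argument: if \<open>q t < 0\<close>, compactness gives a last time
  \<open>s < t\<close> with \<open>0 \<le> q s\<close>. Between \<open>s\<close> and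
  \<open>t\<close> the function is negative, so its derivative is nonnegative there, and the mean
  value theorem gives \<open>q s \<le> q t\<close>, a contradiction.\<close>

lemma nonneg_invariant:
  fixes q q' :: "real \<Rightarrow> real"
  assumes "0 \<le> q 0"
    and deriv: "\<And>t. t \<ge> 0 \<Longrightarrow> (q has_real_derivative q' t) (at t within {0..})"
    and up: "\<And>t. t \<ge> 0 \<Longrightarrow> q t < 0 \<Longrightarrow> 0 \<le> q' t"
    and "t \<ge> 0"
  shows "0 \<le> q t"
proof (rule ccontr)
  assume neg: "\<not> 0 \<le> q t"
  have cont: "continuous_on {0..} q"
    by (rule DERIV_continuous_on[of _ _ q']) (use deriv in simp)
  define S where "S = {u \<in> {0..t}. 0 \<le> q u}"
  have "closed S"
    unfolding S_def
    by (intro continuous_on_closed_Collect_le continuous_on_subset[OF cont]) auto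
  then have "compact S"
    by (metis (lifting) S_def bounded_closed_interval bounded_subset compact_eq_bounded_closed
        mem_Collect_eq subsetI)
  moreover have "0 \<in> S"
    using assms by (simp add: S_def)
  ultimately obtain s where s: "s \<in> S" "\<And>u. u \<in> S \<Longrightarrow> u \<le> s"
    by (metis compact_attains_sup empty_iff)
  have "s < t" "0 \<le> s" "0 \<le> q s"
    using s(1) neg by (auto simp: S_def less_le)
  obtain z where z: "s < z" "z < t" "q t - q s = q' z * (t - s)"
  proof (rule mvt[OF \<open>s < t\<close>, of q "\<lambda>z. (*) (q' z)"])
    show "continuous_on {s..t} q"
      using \<open>0 \<le> s\<close> by (intro continuous_on_subset[OF cont]) auto
    show "(q has_derivative (*) (q' x)) (at x)" if "s < x" "x < t" for x
      using deriv[of x] that \<open>0 \<le> s\<close>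
      by (simp add: at_within_atLeast_interior has_field_derivative_def)
  qed auto
  have "z \<notin> S"
    using s(2) z(1) by force
  then have "0 \<le> q' z"
    using up[of z] z \<open>0 \<le> s\<close> by (auto simp: S_def)
  then have "q s \<le> q t"
    using z(3) \<open>s < t\<close> by (smt (verit) mult_nonneg_nonneg)
  then show False
    using neg \<open>0 \<le> q s\<close> by simp
qed

lemma antiderivative_half_line:
  fixes h :: "real \<Rightarrow> real"
  assumes "continuous_on {0..} h"
  obtains H where "H 0 = 0" "\<And>t. t \<ge> 0 \<Longrightarrow> (H has_real_derivative h t) (at t within {0..})"
proof (rule that[of "\<lambda>t. integral {0..t} h"])
  show "integral {0..0} h = 0"
    by simp
  show "((\<lambda>t. integral {0..t} h) has_real_derivative h t) (at t within {0..})" if "t \<ge> 0" for t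
  proof -
    have "((\<lambda>t. integral {0..t} h) has_real_derivative h t) (at t within {0..t + 1})"
      using that by (intro integral_has_real_derivative continuous_on_subset[OF assms]) auto
    \<comment> \<open>The right end \<open>t + 1\<close> lies beyond \<open>t\<close>, so the
      compact interval and the half-line agree near \<open>t\<close>.\<close>
    moreover have "at t within {0..t + 1} = at t within {0..}"
      by (rule at_within_nhd[of _ "{..<t + 1}"]) auto
    ultimately show ?thesis
      by simp
  qed
qed

section \<open>The continuous version (A)\<close>

lemma solution_A_iff:
  "solution_A m \<epsilon> \<Lambda> \<delta> \<sigma> \<Lambda>0 q \<longleftrightarrow> q 0 = \<Lambda>0 \<and>
     (\<forall>t\<ge>0. (q has_real_derivative net_inflow m \<epsilon> \<Lambda> \<delta> \<sigma> t (q t)) (at t within {0..}))"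
  by (simp add: solution_A_def net_inflow_def)

lemma solution_A_mirror:
  assumes "solution_A m \<epsilon> \<Lambda> \<delta> \<sigma> \<Lambda>0 q"
  shows "solution_A (mirror m) \<epsilon> \<Lambda> \<sigma> \<delta> (\<Lambda> - \<Lambda>0) (\<lambda>t. \<Lambda> - q t)"
  using assms by (auto simp: solution_A_iff net_inflow_mirror intro!: derivative_eq_intros)

lemma continuous_well_defined_A_mirror:
  assumes "continuous_well_defined_A m \<epsilon> \<Lambda> \<delta>0 \<sigma>0"
  shows "continuous_well_defined_A (mirror m) \<epsilon> \<Lambda> \<sigma>0 \<delta>0"
  unfolding continuous_well_defined_A_def
proof clarify
  fix \<sigma> \<delta> \<Lambda>0 q t
  assume data: "(\<sigma>, \<delta>) \<in> boundary_data (mirror m) \<sigma>0 \<delta>0" and "\<Lambda>0 \<in> {0..\<Lambda>}" "0 \<le> (t::real)"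
    and "solution_A (mirror m) \<epsilon> \<Lambda> \<sigma> \<delta> \<Lambda>0 q"
  then have "solution_A m \<epsilon> \<Lambda> \<delta> \<sigma> (\<Lambda> - \<Lambda>0) (\<lambda>t. \<Lambda> - q t)"
    using solution_A_mirror by fastforce
  moreover have "\<Lambda> - \<Lambda>0 \<in> {0..\<Lambda>}"
    using \<open>\<Lambda>0 \<in> {0..\<Lambda>}\<close> by simp
  ultimately have "\<Lambda> - q t \<in> {0..\<Lambda>}"
    using assms data \<open>0 \<le> t\<close> unfolding continuous_well_defined_A_def boundary_data_mirror by fast
  then show "q t \<in> {0..\<Lambda>}"
    by simp
qed

lemma solution_A_nonneg:
  assumes "\<epsilon> > 0" "\<Lambda> > 0" "admissible \<delta>0" "admissible \<sigma>0"
    and "capacity_condition m \<epsilon> \<Lambda> \<delta>0 \<sigma>0" "(\<delta>, \<sigma>) \<in> boundary_data m \<delta>0 \<sigma>0"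
    and sol: "solution_A m \<epsilon> \<Lambda> \<delta> \<sigma> \<Lambda>0 q" and "0 \<le> \<Lambda>0" "t \<ge> 0"
  shows "0 \<le> q t"
proof (rule nonneg_invariant[of q "\<lambda>t. net_inflow m \<epsilon> \<Lambda> \<delta> \<sigma> t (q t)"])
  show "0 \<le> net_inflow m \<epsilon> \<Lambda> \<delta> \<sigma> u (q u)" if "u \<ge> 0" "q u < 0" for u
    using net_inflow_lower_bound[of \<epsilon> \<Lambda> "q u" u \<delta>0 \<sigma>0 \<delta> \<sigma> m] assms that by simp
qed (use assms in \<open>auto simp: solution_A_iff\<close>)

lemma continuous_well_defined_A_if_capacity:
  assumes "\<epsilon> > 0" "\<Lambda> > 0" "admissible \<delta>0" "admissible \<sigma>0"
    and cap: "capacity_condition m \<epsilon> \<Lambda> \<delta>0 \<sigma>0"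
  shows "continuous_well_defined_A m \<epsilon> \<Lambda> \<delta>0 \<sigma>0"
  unfolding continuous_well_defined_A_def
proof clarify
  fix \<delta> \<sigma> \<Lambda>0 q t
  assume data: "(\<delta>, \<sigma>) \<in> boundary_data m \<delta>0 \<sigma>0" and "\<Lambda>0 \<in> {0..\<Lambda>}" "0 \<le> (t::real)"
    and sol: "solution_A m \<epsilon> \<Lambda> \<delta> \<sigma> \<Lambda>0 q"
  have "0 \<le> q t"
    using solution_A_nonneg[OF assms data sol] \<open>\<Lambda>0 \<in> {0..\<Lambda>}\<close> \<open>0 \<le> t\<close> by simp
  moreover have "0 \<le> \<Lambda> - q t"
    using solution_A_nonneg[of \<epsilon> \<Lambda> \<sigma>0 \<delta>0 "mirror m" \<sigma> \<delta> "\<Lambda> - \<Lambda>0" "\<lambda>t. \<Lambda> - q t"]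
      assms data solution_A_mirror[OF sol] \<open>\<Lambda>0 \<in> {0..\<Lambda>}\<close> \<open>0 \<le> t\<close>
    by (simp add: capacity_condition_mirror boundary_data_mirror)
  ultimately show "q t \<in> {0..\<Lambda>}"
    by simp
qed

text \<open>Integrating factor \<open>exp (t / \<epsilon>)\<close>: with \<open>H\<close> an
  antiderivative of \<open>exp (t / \<epsilon>) * h t\<close>, the solution is
  \<open>- exp (- t / \<epsilon>) * H t\<close>, and its sign comes from
  \<open>0 \<le> H t\<close>.\<close>

lemma linear_decay_solution:
  fixes h :: "real \<Rightarrow> real"
  assumes "continuous_on {0..} h" "\<And>t. t \<ge> 0 \<Longrightarrow> 0 \<le> h t" "\<epsilon> \<noteq> 0"
  obtains q where "q 0 = 0" "\<And>t. t \<ge> 0 \<Longrightarrow> q t \<le> 0"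
    "\<And>t. t \<ge> 0 \<Longrightarrow> (q has_real_derivative - q t / \<epsilon> - h t) (at t within {0..})"
proof -
  have "continuous_on {0..} (\<lambda>t. exp (t / \<epsilon>) * h t)"
    unfolding divide_inverse by (intro continuous_intros assms)
  then obtain H where H: "H 0 = 0"
    "\<And>t. t \<ge> 0 \<Longrightarrow> (H has_real_derivative exp (t / \<epsilon>) * h t) (at t within {0..})"
    using antiderivative_half_line by blast
  have "0 \<le> H t" if "t \<ge> 0" for t
    using nonneg_invariant[of H, OF _ H(2)] H(1) assms(2) that by simp
  moreover have "((\<lambda>t. - exp (- t / \<epsilon>) * H t) has_real_derivative
      - (- exp (- t / \<epsilon>) * H t) / \<epsilon> - h t) (at t within {0..})" if "t \<ge> 0" for t
    by (rule DERIV_cong[OF DERIV_mult[OF _ H(2)[OF that]],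
          of _ "exp (- t / \<epsilon>) / \<epsilon>"])
      (use assms(3) in \<open>auto simp: exp_minus field_simps intro!: derivative_eq_intros\<close>)
  ultimately show ?thesis
    using H(1) by (intro that[of "\<lambda>t. - exp (- t / \<epsilon>) * H t"]) auto
qed

lemma PQM3_capacity_if_continuous_well_defined_A:
  assumes "\<epsilon> > 0" "\<Lambda> > 0" "admissible \<sigma>0"
    and wd: "continuous_well_defined_A PQM3 \<epsilon> \<Lambda> \<delta>0 \<sigma>0" and "t \<ge> 0"
  shows "\<sigma>0 t \<le> \<Lambda> / \<epsilon>"
proof -
  define h where "h = (\<lambda>t. max 0 (\<sigma>0 t - \<Lambda> / \<epsilon>))"
  have "continuous_on {0..} h"
    using assms unfolding h_def by (intro continuous_intros) (auto simp: admissible_def)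
  then obtain q where q: "q 0 = 0" "\<And>t. t \<ge> 0 \<Longrightarrow> q t \<le> 0"
    "\<And>t. t \<ge> 0 \<Longrightarrow> (q has_real_derivative - q t / \<epsilon> - h t) (at t within {0..})"
    by (rule linear_decay_solution[of h \<epsilon>]) (use \<open>\<epsilon> > 0\<close> in \<open>auto simp: h_def\<close>)
  \<comment> \<open>The demand is read off from a trajectory already fixed; \<open>q \<le> 0\<close>
    makes it nonnegative, hence admissible.\<close>
  define \<delta> where "\<delta> = (\<lambda>t. \<sigma>0 t - q t / \<epsilon>)"
  have "continuous_on {0..} q"
    by (rule DERIV_continuous_on[of _ _ "\<lambda>t. - q t / \<epsilon> - h t"]) (use q(3) in simp)
  then have "continuous_on {0..} \<delta>"
    using assms unfolding \<delta>_def by (intro continuous_intros) (auto simp: admissible_def)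
  moreover have "0 \<le> \<delta> t" if "t \<ge> 0" for t
    using q(2)[OF that] assms that divide_nonpos_pos[of "q t" \<epsilon>]
    by (simp add: \<delta>_def admissible_def) (smt (verit))
  ultimately have "(\<delta>, \<sigma>0) \<in> boundary_data PQM3 \<delta>0 \<sigma>0"
    by (simp add: admissible_def)
  \<comment> \<open>The queue demand equals \<open>\<sigma>0 t\<close>, so this is the outflow,
    while the inflow is \<open>min (\<sigma>0 t) (\<Lambda> / \<epsilon>) - q t /
    \<epsilon>\<close>.\<close>
  moreover have "net_inflow PQM3 \<epsilon> \<Lambda> \<delta> \<sigma>0 t (q t) = - q t / \<epsilon> - h t" for t
    by (simp add: net_inflow_def \<delta>_def h_def diff_divide_distrib)
  then have "solution_A PQM3 \<epsilon> \<Lambda> \<delta> \<sigma>0 0 q"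
    using q by (simp add: solution_A_iff)
  moreover have "0 \<in> {0..\<Lambda>}"
    using assms by simp
  ultimately have "\<forall>t\<ge>0. q t \<in> {0..\<Lambda>}"
    using wd unfolding continuous_well_defined_A_def by fast
  \<comment> \<open>Well-definedness and \<open>q \<le> 0\<close> leave only the zero solution, so
    its derivative, and with it the excess \<open>h\<close>, vanishes.\<close>
  then have zero: "q u = 0" if "u \<ge> 0" for u
    using q(2)[OF that] that by force
  have "(q has_real_derivative 0) (at t within {0..})"
    by (rule has_field_derivative_transform_within[of "\<lambda>_. 0" _ _ _ 1]) (use zero \<open>t \<ge> 0\<close> in auto)
  \<comment> \<open>Derivatives are unique only at non-isolated points; at \<open>t = 0\<close> the
    filter is one-sided.\<close>
  moreover have "at t within {0..} \<noteq> bot"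
    using \<open>t \<ge> 0\<close> by (cases "t = 0") (auto simp: at_within_atLeast_interior at_within_Ici_at_right)
  ultimately have "- q t / \<epsilon> - h t = 0"
    using q(3)[OF \<open>t \<ge> 0\<close>] has_field_derivative_unique by blast
  then show ?thesis
    using zero[OF \<open>t \<ge> 0\<close>] by (simp add: h_def)
qed

lemma continuous_well_defined_A_iff_capacity:
  assumes "\<epsilon> > 0" "\<Lambda> > 0" "admissible \<delta>0" "admissible \<sigma>0"
  shows "continuous_well_defined_A m \<epsilon> \<Lambda> \<delta>0 \<sigma>0 \<longleftrightarrow> capacity_condition m \<epsilon> \<Lambda> \<delta>0 \<sigma>0"
proof
  assume wd: "continuous_well_defined_A m \<epsilon> \<Lambda> \<delta>0 \<sigma>0"
  show "capacity_condition m \<epsilon> \<Lambda> \<delta>0 \<sigma>0"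
  proof (cases m)
    case PQM3
    then show ?thesis
      using PQM3_capacity_if_continuous_well_defined_A[OF assms(1,2,4)] wd by simp
  next
    case PQM4
    then show ?thesis
      using PQM3_capacity_if_continuous_well_defined_A[OF assms(1-3)]
        continuous_well_defined_A_mirror[OF wd] by simp
  qed auto
qed (use continuous_well_defined_A_if_capacity assms in blast)

section \<open>Equivalence of the continuous versions (A) and (B)\<close>

lemma continuous_queue_demand:
  assumes "continuous_on S \<delta>" "continuous_on S q"
  shows "continuous_on S (\<lambda>t. queue_demand m \<epsilon> \<delta> t (q t))"
  using assms by (cases m) (auto simp: divide_inverse intro!: continuous_intros)

text \<open>The difference \<open>F - G\<close> of a solution of (B) solves (A). Conversely, a
  solution \<open>q\<close> of (A) lifts to (B): its outflow is continuous in time, so it integrates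
  to some \<open>G\<close>, and \<open>F = q + G\<close>.\<close>

lemma continuous_well_defined_B_iff_A:
  assumes "admissible \<delta>0" "admissible \<sigma>0"
  shows "continuous_well_defined_B m \<epsilon> \<Lambda> \<delta>0 \<sigma>0 \<longleftrightarrow> continuous_well_defined_A m \<epsilon> \<Lambda> \<delta>0 \<sigma>0"
proof
  assume A: "continuous_well_defined_A m \<epsilon> \<Lambda> \<delta>0 \<sigma>0"
  show "continuous_well_defined_B m \<epsilon> \<Lambda> \<delta>0 \<sigma>0"
    unfolding continuous_well_defined_B_def
  proof clarify
    fix \<delta> \<sigma> \<Lambda>0 F G t
    assume data: "(\<delta>, \<sigma>) \<in> boundary_data m \<delta>0 \<sigma>0" "\<Lambda>0 \<in> {0..\<Lambda>}" "0 \<le> (t::real)"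
      and sol: "solution_B m \<epsilon> \<Lambda> \<delta> \<sigma> \<Lambda>0 F G"
    have "solution_A m \<epsilon> \<Lambda> \<delta> \<sigma> \<Lambda>0 (\<lambda>t. F t - G t)"
      using sol unfolding solution_A_def solution_B_def by (auto intro: derivative_intros)
    then have "F t - G t \<in> {0..\<Lambda>}"
      using A data unfolding continuous_well_defined_A_def by fast
    then show "G t \<le> F t \<and> F t \<le> G t + \<Lambda>"
      by auto
  qed
next
  assume B: "continuous_well_defined_B m \<epsilon> \<Lambda> \<delta>0 \<sigma>0"
  show "continuous_well_defined_A m \<epsilon> \<Lambda> \<delta>0 \<sigma>0"
    unfolding continuous_well_defined_A_def
  proof clarify
    fix \<delta> \<sigma> \<Lambda>0 q t
    assume data: "(\<delta>, \<sigma>) \<in> boundary_data m \<delta>0 \<sigma>0" "\<Lambda>0 \<in> {0..\<Lambda>}" "0 \<le> (t::real)"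
      and sol: "solution_A m \<epsilon> \<Lambda> \<delta> \<sigma> \<Lambda>0 q"
    have "continuous_on {0..} q"
      by (rule DERIV_continuous_on[of _ _ "\<lambda>t. net_inflow m \<epsilon> \<Lambda> \<delta> \<sigma> t (q t)"])
        (use sol in \<open>simp add: solution_A_iff\<close>)
    then have "continuous_on {0..} (\<lambda>t. min (queue_demand m \<epsilon> \<delta> t (q t)) (\<sigma> t))"
      using boundary_data_admissible[OF assms data(1)]
      by (intro continuous_intros continuous_queue_demand) (auto simp: admissible_def)
    then obtain G where G: "G 0 = 0" "\<And>t. t \<ge> 0 \<Longrightarrow>
        (G has_real_derivative min (queue_demand m \<epsilon> \<delta> t (q t)) (\<sigma> t)) (at t within {0..})"
      using antiderivative_half_line by blast
    have "((\<lambda>t. q t + G t) has_real_derivative min (\<delta> t) (queue_supply m \<epsilon> \<Lambda> \<sigma> t (q t)))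
        (at t within {0..})" if "t \<ge> 0" for t
      using DERIV_add[OF _ G(2)[OF that]] sol that unfolding solution_A_def by fastforce
    then have "solution_B m \<epsilon> \<Lambda> \<delta> \<sigma> \<Lambda>0 (\<lambda>t. q t + G t) G"
      using sol G by (simp add: solution_B_def solution_A_def)
    then have "G t \<le> q t + G t \<and> q t + G t \<le> G t + \<Lambda>"
      using B data unfolding continuous_well_defined_B_def by fast
    then show "q t \<in> {0..\<Lambda>}"
      by simp
  qed
qed

section \<open>The discrete version (A)\<close>

lemma step_A_net_inflow:
  "dt \<ge> 0 \<Longrightarrow> step_A m \<epsilon> \<Lambda> dt \<delta> \<sigma> t l = l + dt * net_inflow m \<epsilon> \<Lambda> \<delta> \<sigma> t l"
  by (simp add: step_A_def net_inflow_def right_diff_distrib min_mult_distrib_left mult.commute)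

lemma step_A_mirror:
  "dt \<ge> 0 \<Longrightarrow> step_A (mirror m) \<epsilon> \<Lambda> dt \<sigma> \<delta> t (\<Lambda> - l) = \<Lambda> - step_A m \<epsilon> \<Lambda> dt \<delta> \<sigma> t l"
  by (simp add: step_A_net_inflow net_inflow_mirror)

lemma discrete_well_defined_A_mirror:
  assumes "dt \<ge> 0" "discrete_well_defined_A m \<epsilon> \<Lambda> dt \<delta>0 \<sigma>0"
  shows "discrete_well_defined_A (mirror m) \<epsilon> \<Lambda> dt \<sigma>0 \<delta>0"
  unfolding discrete_well_defined_A_def
proof clarify
  fix \<sigma> \<delta> t l
  assume "(\<sigma>, \<delta>) \<in> boundary_data (mirror m) \<sigma>0 \<delta>0" "0 \<le> (t::real)" "l \<in> {0..\<Lambda>}"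
  moreover from this have "\<Lambda> - l \<in> {0..\<Lambda>}"
    by simp
  ultimately have "step_A m \<epsilon> \<Lambda> dt \<delta> \<sigma> t (\<Lambda> - l) \<in> {0..\<Lambda>}"
    using assms unfolding discrete_well_defined_A_def boundary_data_mirror by fast
  then show "step_A (mirror m) \<epsilon> \<Lambda> dt \<sigma> \<delta> t l \<in> {0..\<Lambda>}"
    using step_A_mirror[OF assms(1), of m \<epsilon> \<Lambda> \<sigma> \<delta> t "\<Lambda> - l"] by simp
qed

text \<open>A step removes at most \<open>dt * (l / \<epsilon>)\<close>, which is at most
  \<open>l\<close> when \<open>dt \<le> \<epsilon>\<close>.\<close>

lemma step_A_nonneg:
  assumes "\<epsilon> > 0" "\<Lambda> > 0" "dt > 0" "dt \<le> \<epsilon>" "admissible \<delta>0" "admissible \<sigma>0"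
    and "capacity_condition m \<epsilon> \<Lambda> \<delta>0 \<sigma>0" "(\<delta>, \<sigma>) \<in> boundary_data m \<delta>0 \<sigma>0"
    and "t \<ge> 0" "0 \<le> l" "l \<le> \<Lambda>"
  shows "0 \<le> step_A m \<epsilon> \<Lambda> dt \<delta> \<sigma> t l"
proof -
  have "dt * - (l / \<epsilon>) \<le> dt * net_inflow m \<epsilon> \<Lambda> \<delta> \<sigma> t l"
    using net_inflow_lower_bound[of \<epsilon> \<Lambda> l t \<delta>0 \<sigma>0 \<delta> \<sigma> m] assms
    by (intro mult_left_mono) (auto simp: max_def)
  moreover have "dt * l \<le> \<epsilon> * l"
    using assms by (intro mult_right_mono)
  then have "dt * (l / \<epsilon>) \<le> l"
    using assms by (simp add: field_simps)
  ultimately show ?thesis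
    using assms by (simp add: step_A_net_inflow)
qed

lemma discrete_well_defined_A_if_capacity:
  assumes "\<epsilon> > 0" "\<Lambda> > 0" "dt > 0" "dt \<le> \<epsilon>" "admissible \<delta>0" "admissible \<sigma>0"
    and cap: "capacity_condition m \<epsilon> \<Lambda> \<delta>0 \<sigma>0"
  shows "discrete_well_defined_A m \<epsilon> \<Lambda> dt \<delta>0 \<sigma>0"
  unfolding discrete_well_defined_A_def
proof clarify
  fix \<delta> \<sigma> t l
  assume data: "(\<delta>, \<sigma>) \<in> boundary_data m \<delta>0 \<sigma>0" and "0 \<le> (t::real)" "l \<in> {0..\<Lambda>}"
  have "0 \<le> step_A m \<epsilon> \<Lambda> dt \<delta> \<sigma> t l"
    using step_A_nonneg[OF assms data] \<open>l \<in> {0..\<Lambda>}\<close> \<open>0 \<le> t\<close> by simp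
  moreover have "0 \<le> step_A (mirror m) \<epsilon> \<Lambda> dt \<sigma> \<delta> t (\<Lambda> - l)"
    using step_A_nonneg[of \<epsilon> \<Lambda> dt \<sigma>0 \<delta>0 "mirror m" \<sigma> \<delta> t "\<Lambda> - l"]
      assms data \<open>l \<in> {0..\<Lambda>}\<close> \<open>0 \<le> t\<close>
    by (simp add: capacity_condition_mirror boundary_data_mirror)
  ultimately show "step_A m \<epsilon> \<Lambda> dt \<delta> \<sigma> t l \<in> {0..\<Lambda>}"
    using \<open>dt > 0\<close> by (simp add: step_A_mirror)
qed

lemma admissible_const [simp]: "admissible (\<lambda>_. c) \<longleftrightarrow> 0 \<le> c"
  by (auto simp: admissible_def)

text \<open>Without demand nothing enters, and a supply of at least \<open>l / \<epsilon>\<close>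
  lets the queue discharge at exactly that rate. The amount \<open>dt * (l / \<epsilon>)\<close>
  must not exceed \<open>l\<close>.\<close>

lemma emptying_step_bound:
  assumes "discrete_well_defined_A m \<epsilon> \<Lambda> dt \<delta>0 \<sigma>0" "((\<lambda>_. 0), \<sigma>) \<in> boundary_data m \<delta>0 \<sigma>0"
    and "\<epsilon> > 0" "dt > 0" "t \<ge> 0" "0 < l" "l \<le> \<Lambda>" "0 \<le> \<sigma> t" "l / \<epsilon> \<le> \<sigma> t"
  shows "dt \<le> \<epsilon>"
proof -
  have "l \<in> {0..\<Lambda>}"
    using assms by simp
  then have "step_A m \<epsilon> \<Lambda> dt (\<lambda>_. 0) \<sigma> t l \<in> {0..\<Lambda>}"
    using assms(1,2,5) unfolding discrete_well_defined_A_def by fast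
  moreover have "net_inflow m \<epsilon> \<Lambda> (\<lambda>_. 0) \<sigma> t l = - (l / \<epsilon>)"
    using assms by (cases m) (auto simp: net_inflow_def)
  ultimately have "dt * (l / \<epsilon>) \<le> l"
    using \<open>dt > 0\<close> by (simp add: step_A_net_inflow)
  then show ?thesis
    using assms by (simp add: field_simps)
qed

text \<open>One step from the empty queue under large demand yields the capacity bound, because the
  result is nonnegative. The bound on \<open>dt\<close> comes from the same step if the supply
  vanishes at \<open>t\<close>, and from an emptying step otherwise.\<close>

lemma PQM3_discrete_well_defined_A_bounds:
  assumes "\<epsilon> > 0" "\<Lambda> > 0" "dt > 0" "admissible \<sigma>0"
    and wd: "discrete_well_defined_A PQM3 \<epsilon> \<Lambda> dt \<delta>0 \<sigma>0" and "t \<ge> 0"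
  shows "\<sigma>0 t \<le> \<Lambda> / \<epsilon>" "dt \<le> \<epsilon>"
proof -
  have nonneg: "0 \<le> \<sigma>0 t"
    using assms by (simp add: admissible_def)
  \<comment> \<open>Large enough that at \<open>l = 0\<close> the inflow is
    \<open>\<Lambda> / \<epsilon>\<close> and the outflow is \<open>\<sigma>0 t\<close>.\<close>
  define \<delta> where "\<delta> = (\<lambda>_::real. \<Lambda> / \<epsilon> + \<sigma>0 t)"
  have "(\<delta>, \<sigma>0) \<in> boundary_data PQM3 \<delta>0 \<sigma>0"
    using assms nonneg by (simp add: \<delta>_def)
  moreover have "0 \<in> {0..\<Lambda>}"
    using assms by simp
  ultimately have "step_A PQM3 \<epsilon> \<Lambda> dt \<delta> \<sigma>0 t 0 \<in> {0..\<Lambda>}"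
    using wd \<open>t \<ge> 0\<close> unfolding discrete_well_defined_A_def by fast
  moreover have "net_inflow PQM3 \<epsilon> \<Lambda> \<delta> \<sigma>0 t 0 = \<Lambda> / \<epsilon> - \<sigma>0 t"
    using assms nonneg by (simp add: net_inflow_def \<delta>_def)
  ultimately have filling: "0 \<le> dt * (\<Lambda> / \<epsilon> - \<sigma>0 t)" "dt * (\<Lambda> / \<epsilon> - \<sigma>0 t) \<le> \<Lambda>"
    using \<open>dt > 0\<close> by (auto simp: step_A_net_inflow)
  then show "\<sigma>0 t \<le> \<Lambda> / \<epsilon>"
    using \<open>dt > 0\<close> by (simp add: zero_le_mult_iff)
  show "dt \<le> \<epsilon>"
  proof (cases "\<sigma>0 t = 0")
    case True
    then show ?thesis
      using filling(2) assms by (simp add: field_simps)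
  next
    case False
    \<comment> \<open>The largest queue within capacity that the given supply can discharge at rate
      \<open>l / \<epsilon>\<close>.\<close>
    define l where "l = min \<Lambda> (\<epsilon> * \<sigma>0 t)"
    have "l / \<epsilon> \<le> \<sigma>0 t"
      using \<open>\<epsilon> > 0\<close> by (simp add: l_def pos_divide_le_eq mult.commute)
    moreover have "0 < l" "l \<le> \<Lambda>"
      using False nonneg assms by (auto simp: l_def)
    ultimately show ?thesis
      using emptying_step_bound[OF wd, of \<sigma>0 t l] assms nonneg by simp
  qed
qed

lemma discrete_well_defined_A_iff_capacity:
  assumes "\<epsilon> > 0" "\<Lambda> > 0" "dt > 0" "admissible \<delta>0" "admissible \<sigma>0"
  shows "discrete_well_defined_A m \<epsilon> \<Lambda> dt \<delta>0 \<sigma>0 \<longleftrightarrow>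
    capacity_condition m \<epsilon> \<Lambda> \<delta>0 \<sigma>0 \<and> dt \<le> \<epsilon>"
proof
  assume wd: "discrete_well_defined_A m \<epsilon> \<Lambda> dt \<delta>0 \<sigma>0"
  show "capacity_condition m \<epsilon> \<Lambda> \<delta>0 \<sigma>0 \<and> dt \<le> \<epsilon>"
  proof (cases m)
    case PQM1
    then show ?thesis
      \<comment> \<open>Here the supply is free: the constant \<open>\<Lambda> / \<epsilon>\<close>
        is just enough to discharge a full queue.\<close>
      using emptying_step_bound[OF wd, of "\<lambda>_. \<Lambda> / \<epsilon>" 0 \<Lambda>] assms by simp
  next
    case PQM2
    then show ?thesis
      using emptying_step_bound[OF wd, of "\<lambda>_. \<Lambda> / \<epsilon>" 0 \<Lambda>] assms by simp
  next
    case PQM3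
    then show ?thesis
      using PQM3_discrete_well_defined_A_bounds[OF assms(1-3,5)] wd by auto
  next
    case PQM4
    then show ?thesis
      using PQM3_discrete_well_defined_A_bounds[OF assms(1-4)]
        discrete_well_defined_A_mirror[OF _ wd] \<open>dt > 0\<close> by auto
  qed
qed (use discrete_well_defined_A_if_capacity assms in blast)

section \<open>Equivalence of the discrete versions (A) and (B)\<close>

lemma discrete_well_defined_B_iff_A:
  "discrete_well_defined_B m \<epsilon> \<Lambda> dt \<delta>0 \<sigma>0 \<longleftrightarrow> discrete_well_defined_A m \<epsilon> \<Lambda> dt \<delta>0 \<sigma>0"
proof
  assume A: "discrete_well_defined_A m \<epsilon> \<Lambda> dt \<delta>0 \<sigma>0"
  show "discrete_well_defined_B m \<epsilon> \<Lambda> dt \<delta>0 \<sigma>0"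
    unfolding discrete_well_defined_B_def
  proof (clarify del: conjI)
    fix \<delta> \<sigma> t f g f' g'
    assume data: "(\<delta>, \<sigma>) \<in> boundary_data m \<delta>0 \<sigma>0" "0 \<le> (t::real)"
      and "g \<le> f" "f \<le> g + \<Lambda>" and step: "step_B m \<epsilon> \<Lambda> dt \<delta> \<sigma> t (f, g) = (f', g')"
    then have "f - g \<in> {0..\<Lambda>}"
      by simp
    then have "step_A m \<epsilon> \<Lambda> dt \<delta> \<sigma> t (f - g) \<in> {0..\<Lambda>}"
      using A data unfolding discrete_well_defined_A_def by fast
    moreover have "step_A m \<epsilon> \<Lambda> dt \<delta> \<sigma> t (f - g) = f' - g'"
      using step by (auto simp: step_A_def step_B_def)
    ultimately show "g' \<le> f' \<and> f' \<le> g' + \<Lambda>"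
      by auto
  qed
next
  assume B: "discrete_well_defined_B m \<epsilon> \<Lambda> dt \<delta>0 \<sigma>0"
  show "discrete_well_defined_A m \<epsilon> \<Lambda> dt \<delta>0 \<sigma>0"
    unfolding discrete_well_defined_A_def
  proof clarify
    fix \<delta> \<sigma> t l
    assume data: "(\<delta>, \<sigma>) \<in> boundary_data m \<delta>0 \<sigma>0" "0 \<le> (t::real)" and l: "l \<in> {0..\<Lambda>}"
    \<comment> \<open>The flows matter only through their difference, so \<open>(l, 0)\<close>
      represents the queue size \<open>l\<close>.\<close>
    obtain f' g' where step: "step_B m \<epsilon> \<Lambda> dt \<delta> \<sigma> t (l, 0) = (f', g')"
      by fastforce
    have "0 \<le> l \<and> l \<le> 0 + \<Lambda>"
      using l by simp
    then have "g' \<le> f' \<and> f' \<le> g' + \<Lambda>"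
      using B data step unfolding discrete_well_defined_B_def by fast
    moreover have "step_A m \<epsilon> \<Lambda> dt \<delta> \<sigma> t l = f' - g'"
      using step by (auto simp: step_A_def step_B_def)
    ultimately show "step_A m \<epsilon> \<Lambda> dt \<delta> \<sigma> t l \<in> {0..\<Lambda>}"
      by auto
  qed
qed

theorem theorem4p2:
  fixes m :: pqm and \<epsilon> \<Lambda> dt :: real and \<delta>0 \<sigma>0 :: "real \<Rightarrow> real"
  assumes "\<epsilon> > 0" and "\<Lambda> > 0" and "dt > 0"
    and "admissible \<delta>0" and "admissible \<sigma>0"
  shows "(discrete_well_defined_A m \<epsilon> \<Lambda> dt \<delta>0 \<sigma>0
           \<longleftrightarrow> continuous_well_defined_A m \<epsilon> \<Lambda> \<delta>0 \<sigma>0 \<and> dt \<le> \<epsilon>)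
       \<and> (discrete_well_defined_B m \<epsilon> \<Lambda> dt \<delta>0 \<sigma>0
           \<longleftrightarrow> continuous_well_defined_B m \<epsilon> \<Lambda> \<delta>0 \<sigma>0 \<and> dt \<le> \<epsilon>)"
  using assms
  by (simp add: discrete_well_defined_B_iff_A continuous_well_defined_B_iff_A
      discrete_well_defined_A_iff_capacity continuous_well_defined_A_iff_capacity)

end
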